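(* Let $\overline I=[0,1]$ carry its logarithmic structure at both endpoints, with endpoint scales $\lambda_0,\lambda_1>0$. The maps $I_I,P_I,H_I$ of the context form a special deformation retract $$(\mathfrak R_{\overline I}^\bullet,D_I)\ \underset{I_I}{\overset{P_I}{\rightleftarrows}}\ (C_{\mathrm{nf}}^\bullet(\overline I),d_{\mathrm{nf}}),$$ with $P_II_I=\mathrm{id}$, $D_IH_I+H_ID_I=\mathrm{id}-I_IP_I$, $H_I^2=P_IH_I=H_II_I=0$. This is a retract of the total relative face-diagram complex: the homotopy vanishes on the endpoint summands and is normalized at the left endpoint, but the three maps are not claimed to commute componentwise with both un-totalized endpoint restrictions.
   Context: $A^{0,\log}(\overline I)$ consists of the smooth functions on $(0,1)$ that are smooth polynomials in $\log t$ near $t=0$ (finite sums $\sum f_j(t)(\log t)^j$, $f_j$ smooth up to $0$) and similarly in $\log(1-t)$ near $t=1$; $A^{1,\log}(\overline I)$ is generated over it by $dt$, $dt/t$ near $0$ and $dt/(1-t)$ near $1$; $d$ is the de Rham differential. $\mathrm{Reg}_0$ substitutes $t=0$, $\log t=\log\lambda_0$ in the expansion at $0$; $\mathrm{Reg}_1$ substitutes $t=1$, $\log(1-t)=\log\lambda_1$ in the expansion at $1$. The regularized integral $\mathrm{Tr}:A^{1,\log}(\overline I)\to\mathbb R$ satisfies $\mathrm{Tr}(df)=\mathrm{Reg}_1(f)-\mathrm{Reg}_0(f)$. For each $\eta\in A^{1,\log}(\overline I)$, $\mathsf P_0\eta\in A^{0,\log}(\overline I)$ is the unique element with $d\mathsf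 P_0\eta=\eta$ and $\mathrm{Reg}_0(\mathsf P_0\eta)=0$; then $\mathrm{Reg}_1(\mathsf P_0\eta)=\mathrm{Tr}(\eta)$. $\mathfrak R_{\overline I}^0=A^{0,\log}(\overline I)$; $\mathfrak R^1_{\overline I}=\{(\eta;a_0,a_1):\eta\in A^{1,\log}(\overline I),a_0,a_1\in\mathbb R\}$; $D_If=(df;-\mathrm{Reg}_0f,\mathrm{Reg}_1f)$, $D_I(\eta;a_0,a_1)=0$. $C_{\mathrm{nf}}^0=\mathbb Re$, $C_{\mathrm{nf}}^1=\mathbb Rv_0\oplus\mathbb Rv_1$, $d_{\mathrm{nf}}e=v_1-v_0$. $I_I(e)=1$, $I_I(v_0)=(0;1,0)$, $I_I(v_1)=(0;0,1)$; $P_I(f)=\mathrm{Reg}_0(f)e$, $P_I(\eta;a_0,a_1)=a_0v_0+(a_1-\mathrm{Tr}\,\eta)v_1$; $H_I(f)=0$, $H_I(\eta;a_0,a_1)=\mathsf P_0\eta$. *)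

theory Defs
  imports "HOL-Analysis.Analysis"
begin

section \<open>Smooth functions and logarithmic polynomials\<close>

(* All derivatives are taken within S, so for S = {0..<e} this is smoothness up to the
   boundary point 0 in the one-sided sense. *)
definition smooth_on :: "real set \<Rightarrow> (real \<Rightarrow> real) \<Rightarrow> bool" where
  "smooth_on S f \<longleftrightarrow> (\<exists>D :: nat \<Rightarrow> real \<Rightarrow> real. D 0 = f \<and>
     (\<forall>k. \<forall>t\<in>S. (D k has_real_derivative D (Suc k) t) (at t within S)))"

(* At the endpoint 1 everything is expressed in the boundary coordinate s = 1 - t, i.e. the
   predicates below are applied to s \<mapsto> f (1 - s); then log s is log (1 - t), and smoothness of
   the coefficients in s up to s = 0 is smoothness in t up to t = 1. *)
definition log_expansion :: "nat \<Rightarrow> (nat \<Rightarrow> real \<Rightarrow> real) \<Rightarrow> (real \<Rightarrow> real) \<Rightarrow> bool" where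
  "log_expansion n c f \<longleftrightarrow> (\<exists>e>0. (\<forall>j\<le>n. smooth_on {0..<e} (c j)) \<and>
     (\<forall>t\<in>{0<..<e}. f t = (\<Sum>j\<le>n. c j t * ln t ^ j)))"

definition log_poly :: "(real \<Rightarrow> real) \<Rightarrow> bool" where
  "log_poly f \<longleftrightarrow> (\<exists>n c. log_expansion n c f)"

(* g is the coefficient of a form a dt + b dt/t near t = 0.  At the endpoint 1 the predicate is
   applied to s \<mapsto> g (1 - s) and expresses a dt + b dt/(1 - t). *)
definition log_form_coeff :: "(real \<Rightarrow> real) \<Rightarrow> bool" where
  "log_form_coeff g \<longleftrightarrow> (\<exists>a b. log_poly a \<and> log_poly b \<and>
     (\<forall>\<^sub>F t in at_right 0. g t = a t + b t / t))"

(* Substitute t = 0, log t = log l in an expansion at 0.  The coefficients of an expansion are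
   unique only up to functions flat at 0, but their values at 0 are unique. *)
definition reg :: "real \<Rightarrow> (real \<Rightarrow> real) \<Rightarrow> real" where
  "reg l f = (THE r. \<exists>n c. log_expansion n c f \<and> r = (\<Sum>j\<le>n. c j 0 * ln l ^ j))"

lemma smooth_on_cong:
  assumes "smooth_on S f" "\<And>t. t \<in> S \<Longrightarrow> g t = f t"
  shows "smooth_on S g"
proof -
  from assms(1) obtain D where D: "D 0 = f"
    "\<And>k t. t \<in> S \<Longrightarrow> (D k has_real_derivative D (Suc k) t) (at t within S)"
    unfolding smooth_on_def by blast
  define E where "E k = (if k = 0 then g else D k)" for k
  have "(E k has_real_derivative E (Suc k) t) (at t within S)" if "t \<in> S" for k t
  proof (cases k)
    case 0
    have "(g has_real_derivative D (Suc 0) t) (at t within S)"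
      using has_field_derivative_transform_within[OF D(2)[OF that, of 0], of 1 g] that assms(2) D(1)
      by auto
    then show ?thesis using 0 by (simp add: E_def)
  next
    case (Suc m)
    then show ?thesis using D(2)[OF that, of k] by (simp add: E_def)
  qed
  then show ?thesis unfolding smooth_on_def by (intro exI[of _ E]) (simp add: E_def)
qed

lemma smooth_on_subset: "smooth_on S f \<Longrightarrow> T \<subseteq> S \<Longrightarrow> smooth_on T f"
  unfolding smooth_on_def by (elim exE conjE, rule exI, rule conjI, assumption) (blast intro: DERIV_subset)

lemma smooth_on_const [simp]: "smooth_on S (\<lambda>_. a)"
  unfolding smooth_on_def by (rule exI[of _ "\<lambda>k _. if k = 0 then a else 0"]) auto

lemma smooth_on_add:
  assumes "smooth_on S f" "smooth_on S g"
  shows "smooth_on S (\<lambda>t. f t + g t)"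
proof -
  from assms obtain D E where "D 0 = f" "E 0 = g"
    "\<forall>k. \<forall>t\<in>S. (D k has_real_derivative D (Suc k) t) (at t within S)"
    "\<forall>k. \<forall>t\<in>S. (E k has_real_derivative E (Suc k) t) (at t within S)"
    unfolding smooth_on_def by blast
  then show ?thesis unfolding smooth_on_def
    by (intro exI[of _ "\<lambda>k t. D k t + E k t"]) (auto intro!: DERIV_add)
qed

lemma smooth_on_cmult:
  assumes "smooth_on S f"
  shows "smooth_on S (\<lambda>t. a * f t)"
proof -
  from assms obtain D where "D 0 = f"
    "\<forall>k. \<forall>t\<in>S. (D k has_real_derivative D (Suc k) t) (at t within S)"
    unfolding smooth_on_def by blast
  then show ?thesis unfolding smooth_on_def
    by (intro exI[of _ "\<lambda>k t. a * D k t"]) (auto intro!: DERIV_cmult)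
qed

lemma smooth_on_derivative:
  assumes "smooth_on S f"
  obtains f' where "smooth_on S f'"
    "\<And>t. t \<in> S \<Longrightarrow> (f has_real_derivative f' t) (at t within S)"
proof -
  from assms obtain D where "D 0 = f"
    "\<forall>k. \<forall>t\<in>S. (D k has_real_derivative D (Suc k) t) (at t within S)"
    unfolding smooth_on_def by blast
  then show ?thesis
    by (intro that[of "D 1"]) (auto simp: smooth_on_def intro!: exI[of _ "\<lambda>k. D (Suc k)"])
qed

lemma log_expansion_pad:
  assumes "log_expansion n c f" "n \<le> m"
  shows "log_expansion m (\<lambda>j. if j \<le> n then c j else (\<lambda>_. 0)) f"
proof -
  have "(\<Sum>j\<le>n. c j t * ln t ^ j)
      = (\<Sum>j\<le>m. (if j \<le> n then c j else (\<lambda>_. 0)) t * ln t ^ j)" for t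
    by (rule sum.mono_neutral_cong_left) (use assms(2) in auto)
  with assms(1) show ?thesis unfolding log_expansion_def by fastforce
qed

lemma log_poly_add:
  assumes "log_poly f" "log_poly g"
  shows "log_poly (\<lambda>t. f t + g t)"
proof -
  from assms obtain n c m d where "log_expansion n c f" "log_expansion m d g"
    unfolding log_poly_def by blast
  then obtain c' d' where c: "log_expansion (max n m) c' f" and d: "log_expansion (max n m) d' g"
    using log_expansion_pad max.cobounded1 max.cobounded2 by metis
  define N where "N = max n m"
  obtain e1 where e1: "e1 > 0" "\<forall>j\<le>N. smooth_on {0..<e1} (c' j)"
    "\<forall>t\<in>{0<..<e1}. f t = (\<Sum>j\<le>N. c' j t * ln t ^ j)"
    using c unfolding log_expansion_def N_def by blast
  obtain e2 where e2: "e2 > 0" "\<forall>j\<le>N. smooth_on {0..<e2} (d' j)"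
    "\<forall>t\<in>{0<..<e2}. g t = (\<Sum>j\<le>N. d' j t * ln t ^ j)"
    using d unfolding log_expansion_def N_def by blast
  define e where "e = min e1 e2"
  have "e > 0" using e1 e2 by (simp add: e_def)
  moreover have "\<forall>j\<le>N. smooth_on {0..<e} (\<lambda>t. c' j t + d' j t)"
    using e1(2) e2(2) by (auto intro!: smooth_on_add elim!: smooth_on_subset simp: e_def)
  moreover have "\<forall>t\<in>{0<..<e}. f t + g t = (\<Sum>j\<le>N. (c' j t + d' j t) * ln t ^ j)"
    using e1(3) e2(3) by (auto simp: e_def distrib_right sum.distrib)
  ultimately have "log_expansion N (\<lambda>j t. c' j t + d' j t) (\<lambda>t. f t + g t)"
    unfolding log_expansion_def by (intro exI[of _ e]) simp
  then show ?thesis unfolding log_poly_def by blast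
qed

lemma log_poly_cmult:
  assumes "log_poly f"
  shows "log_poly (\<lambda>t. a * f t)"
proof -
  from assms obtain n c e where e: "e > 0" "\<forall>j\<le>n. smooth_on {0..<e} (c j)"
    "\<forall>t\<in>{0<..<e}. f t = (\<Sum>j\<le>n. c j t * ln t ^ j)"
    unfolding log_poly_def log_expansion_def by blast
  then have "log_expansion n (\<lambda>j t. a * c j t) (\<lambda>t. a * f t)"
    unfolding log_expansion_def
    by (intro exI[of _ e]) (auto simp: sum_distrib_left mult.assoc intro: smooth_on_cmult)
  then show ?thesis unfolding log_poly_def by blast
qed

lemma log_poly_monom:
  assumes "e > 0" "smooth_on {0..<e} h"
  shows "log_poly (\<lambda>t. h t * ln t ^ k)"
proof -
  have "(\<Sum>j\<le>k. (if j = k then h else (\<lambda>_. 0)) t * ln t ^ j) = h t * ln t ^ k" for t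
    by (subst sum.mono_neutral_right[of _ "{k}"]) auto
  with assms have "log_expansion k (\<lambda>j. if j = k then h else (\<lambda>_. 0)) (\<lambda>t. h t * ln t ^ k)"
    unfolding log_expansion_def by (intro exI[of _ e]) auto
  then show ?thesis unfolding log_poly_def by blast
qed

lemma log_poly_const [simp]: "log_poly (\<lambda>_. a)"
  using log_poly_monom[of 1 "\<lambda>_. a" 0] by simp

lemma log_poly_sum:
  "finite A \<Longrightarrow> (\<And>i. i \<in> A \<Longrightarrow> log_poly (h i)) \<Longrightarrow> log_poly (\<lambda>t. \<Sum>i\<in>A. h i t)"
  by (induction A rule: finite_induct) (auto intro: log_poly_add)

lemma log_poly_cong:
  assumes "log_poly f" "\<And>t. 0 < t \<Longrightarrow> t < 1 \<Longrightarrow> g t = f t"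
  shows "log_poly g"
proof -
  from assms(1) obtain n c e where e: "e > 0" "\<forall>j\<le>n. smooth_on {0..<e} (c j)"
    "\<forall>t\<in>{0<..<e}. f t = (\<Sum>j\<le>n. c j t * ln t ^ j)"
    unfolding log_poly_def log_expansion_def by blast
  have "log_expansion n c g"
    unfolding log_expansion_def using e assms(2)
    by (intro exI[of _ "min e 1"]) (auto elim!: smooth_on_subset)
  then show ?thesis unfolding log_poly_def by blast
qed

lemma log_form_coeff_add:
  assumes "log_form_coeff f" "log_form_coeff g"
  shows "log_form_coeff (\<lambda>t. f t + g t)"
proof -
  from assms obtain a b a' b' where h: "log_poly a" "log_poly b" "log_poly a'" "log_poly b'"
    and ev: "\<forall>\<^sub>F t in at_right 0. f t = a t + b t / t"
      "\<forall>\<^sub>F t in at_right 0. g t = a' t + b' t / t"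
    unfolding log_form_coeff_def by blast
  have "\<forall>\<^sub>F t in at_right 0. f t + g t = (a t + a' t) + (b t + b' t) / t"
    using ev by eventually_elim (simp add: add_divide_distrib)
  with h show ?thesis unfolding log_form_coeff_def
    by (intro exI[of _ "\<lambda>t. a t + a' t"] exI[of _ "\<lambda>t. b t + b' t"]) (auto intro: log_poly_add)
qed

lemma log_form_coeff_cmult:
  assumes "log_form_coeff f"
  shows "log_form_coeff (\<lambda>t. x * f t)"
proof -
  from assms obtain a b where h: "log_poly a" "log_poly b"
    and ev: "\<forall>\<^sub>F t in at_right 0. f t = a t + b t / t"
    unfolding log_form_coeff_def by blast
  have "\<forall>\<^sub>F t in at_right 0. x * f t = x * a t + x * b t / t"
    using ev by eventually_elim (simp add: algebra_simps)
  with h show ?thesis unfolding log_form_coeff_def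
    by (intro exI[of _ "\<lambda>t. x * a t"] exI[of _ "\<lambda>t. x * b t"]) (auto intro: log_poly_cmult)
qed

lemma log_form_coeff_zero [simp]: "log_form_coeff (\<lambda>_. 0)"
  unfolding log_form_coeff_def by (rule exI[of _ "\<lambda>_. 0"])+ simp

lemma log_poly_deriv:
  assumes "log_poly f" "\<And>t. 0 < t \<Longrightarrow> t < 1 \<Longrightarrow> (f has_real_derivative f' t) (at t)"
  shows "log_form_coeff f'"
proof -
  from assms(1) obtain n c e where e: "e > 0" "\<And>j. j \<le> n \<Longrightarrow> smooth_on {0..<e} (c j)"
    "\<forall>t\<in>{0<..<e}. f t = (\<Sum>j\<le>n. c j t * ln t ^ j)"
    unfolding log_poly_def log_expansion_def by blast
  have "\<forall>j\<in>{..n}. \<exists>c'. smooth_on {0..<e} c' \<and>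
      (\<forall>t\<in>{0..<e}. (c j has_real_derivative c' t) (at t within {0..<e}))"
    using e(2) by (meson atMost_iff smooth_on_derivative)
  then obtain c' where c': "\<And>j. j \<le> n \<Longrightarrow> smooth_on {0..<e} (c' j)"
    "\<And>j t. j \<le> n \<Longrightarrow> t \<in> {0..<e} \<Longrightarrow> (c j has_real_derivative c' j t) (at t within {0..<e})"
    by (metis atMost_iff)
  define a where "a t = (\<Sum>j\<le>n. c' j t * ln t ^ j)" for t
  define b where "b t = (\<Sum>j\<le>n. (real j * c j t) * ln t ^ (j - 1))" for t
  have eq: "f' t = a t + b t / t" if t: "t \<in> {0<..<min e 1}" for t
  proof -
    have in_int: "t \<in> interior {0..<e}" using t by simp
    have dc: "(c j has_real_derivative c' j t) (at t)" if "j \<le> n" for j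
      using c'(2)[OF that, of t] at_within_interior[OF in_int] t by simp
    have "((\<lambda>t. c j t * ln t ^ j) has_real_derivative
        c' j t * ln t ^ j + (real j * c j t) * ln t ^ (j - 1) / t) (at t)" if "j \<le> n" for j
      using t by (auto intro!: derivative_eq_intros dc that simp: field_simps)
    then have "((\<lambda>t. \<Sum>j\<le>n. c j t * ln t ^ j) has_real_derivative
        (\<Sum>j\<le>n. c' j t * ln t ^ j + (real j * c j t) * ln t ^ (j - 1) / t)) (at t)"
      by (intro DERIV_sum) auto
    moreover have "(\<Sum>j\<le>n. c' j t * ln t ^ j + (real j * c j t) * ln t ^ (j - 1) / t) = a t + b t / t"
      by (simp add: a_def b_def sum.distrib sum_divide_distrib)
    ultimately have "((\<lambda>t. \<Sum>j\<le>n. c j t * ln t ^ j) has_real_derivative a t + b t / t) (at t)"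
      by simp
    then have "(f has_real_derivative a t + b t / t) (at t)"
      by (rule has_field_derivative_transform_within_open[where S = "{0<..<e}"])
        (use e(3) t in auto)
    then show ?thesis using assms(2)[of t] t DERIV_unique by auto
  qed
  have "\<forall>\<^sub>F t in at_right 0. f' t = a t + b t / t"
    by (rule eventually_at_rightI[of 0 "min e 1"]) (use eq e(1) in auto)
  moreover have "log_poly a" unfolding a_def
    by (intro log_poly_sum log_poly_monom[OF e(1)]) (auto intro: c'(1))
  moreover have "log_poly b" unfolding b_def
    by (intro log_poly_sum log_poly_monom[OF e(1)] smooth_on_cmult) (auto intro: e(2))
  ultimately show ?thesis unfolding log_form_coeff_def by blast
qed

section \<open>The logarithmic de Rham complex of the interval\<close>

(* A function on (0,1) is represented by its extension by zero to the real line. *)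
typedef log_fun = "{f :: real \<Rightarrow> real. smooth_on {0<..<1} f \<and> log_poly f \<and>
    log_poly (\<lambda>s. f (1 - s)) \<and> (\<forall>t. t \<notin> {0<..<1} \<longrightarrow> f t = 0)}"
  by (rule exI[of _ "\<lambda>_. 0"]) simp

(* A one-form g dt on (0,1) is represented by its coefficient g, extended by zero. *)
typedef log_form = "{g :: real \<Rightarrow> real. smooth_on {0<..<1} g \<and> log_form_coeff g \<and>
    log_form_coeff (\<lambda>s. g (1 - s)) \<and> (\<forall>t. t \<notin> {0<..<1} \<longrightarrow> g t = 0)}"
  by (rule exI[of _ "\<lambda>_. 0"]) simp

setup_lifting type_definition_log_fun
setup_lifting type_definition_log_form

instantiation log_fun :: real_vector
begin

lift_definition zero_log_fun :: log_fun is "\<lambda>_. 0"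
  by simp

lift_definition plus_log_fun :: "log_fun \<Rightarrow> log_fun \<Rightarrow> log_fun" is "\<lambda>f g t. f t + g t"
  by (auto intro: smooth_on_add log_poly_add)

lift_definition scaleR_log_fun :: "real \<Rightarrow> log_fun \<Rightarrow> log_fun" is "\<lambda>a f t. a * f t"
  by (auto intro: smooth_on_cmult log_poly_cmult)

definition uminus_log_fun :: "log_fun \<Rightarrow> log_fun" where
  "uminus_log_fun f = (-1) *\<^sub>R f"

definition minus_log_fun :: "log_fun \<Rightarrow> log_fun \<Rightarrow> log_fun" where
  "minus_log_fun f g = f + (-1) *\<^sub>R g"

instance
  by standard (unfold uminus_log_fun_def minus_log_fun_def, (transfer; force simp: algebra_simps)+)

end

instantiation log_form :: real_vector
begin

lift_definition zero_log_form :: log_form is "\<lambda>_. 0"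
  by simp

lift_definition plus_log_form :: "log_form \<Rightarrow> log_form \<Rightarrow> log_form" is "\<lambda>f g t. f t + g t"
  by (auto intro: smooth_on_add log_form_coeff_add)

lift_definition scaleR_log_form :: "real \<Rightarrow> log_form \<Rightarrow> log_form" is "\<lambda>a f t. a * f t"
  by (auto intro: smooth_on_cmult log_form_coeff_cmult)

definition uminus_log_form :: "log_form \<Rightarrow> log_form" where
  "uminus_log_form f = (-1) *\<^sub>R f"

definition minus_log_form :: "log_form \<Rightarrow> log_form \<Rightarrow> log_form" where
  "minus_log_form f g = f + (-1) *\<^sub>R g"

instance
  by standard (unfold uminus_log_form_def minus_log_form_def, (transfer; force simp: algebra_simps)+)

end

instantiation log_fun :: one
begin

lift_definition one_log_fun :: log_fun is "\<lambda>t. if t \<in> {0<..<1} then 1 else 0"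
  by (auto intro!: smooth_on_cong[OF smooth_on_const[of _ 1]]
      log_poly_cong[OF log_poly_const[of 1]])

instance ..

end

lift_definition deRham :: "log_fun \<Rightarrow> log_form" is
  "\<lambda>f t. if t \<in> {0<..<1} then deriv f t else 0"
proof -
  fix f :: "real \<Rightarrow> real"
  assume f: "smooth_on {0<..<1} f \<and> log_poly f \<and> log_poly (\<lambda>s. f (1 - s)) \<and>
    (\<forall>t. t \<notin> {0<..<1} \<longrightarrow> f t = 0)"
  let ?g = "\<lambda>t. if t \<in> {0<..<1} then deriv f t else 0"
  obtain f' where f': "smooth_on {0<..<1} f'"
    "\<And>t. t \<in> {0<..<1} \<Longrightarrow> (f has_real_derivative f' t) (at t within {0<..<1})"
    using f smooth_on_derivative by blast
  have df: "(f has_real_derivative f' t) (at t)" if "t \<in> {0<..<1}" for t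
    using f'(2)[OF that] at_within_open[OF that] by simp
  then have g: "?g t = f' t" if "t \<in> {0<..<1}" for t
    using that DERIV_imp_deriv by auto
  have "smooth_on {0<..<1} ?g"
    using f'(1) by (rule smooth_on_cong) (use g in auto)
  moreover have "log_form_coeff ?g"
    by (rule log_poly_deriv[of f]) (use f df g in auto)
  moreover have "log_form_coeff (\<lambda>s. ?g (1 - s))"
  proof -
    have neg: "log_form_coeff (\<lambda>s. - ?g (1 - s))"
    proof (rule log_poly_deriv)
      show "log_poly (\<lambda>s. f (1 - s))" using f by blast
      fix s :: real assume s: "0 < s" "s < 1"
      have "((\<lambda>s. f (1 - s)) has_real_derivative f' (1 - s) * (-1)) (at s)"
        by (rule DERIV_chain2[OF df]) (use s in \<open>auto intro!: derivative_eq_intros\<close>)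
      then show "((\<lambda>s. f (1 - s)) has_real_derivative - ?g (1 - s)) (at s)"
        using g[of "1 - s"] s by simp
    qed
    have "(\<lambda>s. ?g (1 - s)) = (\<lambda>s. (-1) * (- ?g (1 - s)))" by (rule ext) simp
    then show ?thesis using log_form_coeff_cmult[OF neg, of "-1"] by metis
  qed
  ultimately show "smooth_on {0<..<1} ?g \<and> log_form_coeff ?g \<and> log_form_coeff (\<lambda>s. ?g (1 - s)) \<and>
    (\<forall>t. t \<notin> {0<..<1} \<longrightarrow> ?g t = 0)" by simp
qed

definition Reg0 :: "real \<Rightarrow> log_fun \<Rightarrow> real" where
  "Reg0 l0 f = reg l0 (Rep_log_fun f)"

definition Reg1 :: "real \<Rightarrow> log_fun \<Rightarrow> real" where
  "Reg1 l1 f = reg l1 (\<lambda>s. Rep_log_fun f (1 - s))"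

(* The regularized integral: cut the interval at 1/2 and regularize the two partial integrals
   as functions of their free endpoint.  The result does not depend on the cut. *)
definition Tr :: "real \<Rightarrow> real \<Rightarrow> log_form \<Rightarrow> real" where
  "Tr l0 l1 \<eta> = reg l0 (\<lambda>a. integral {a..1/2} (Rep_log_form \<eta>))
             + reg l1 (\<lambda>s. integral {1/2..1 - s} (Rep_log_form \<eta>))"

definition P0 :: "real \<Rightarrow> log_form \<Rightarrow> log_fun" where
  "P0 l0 \<eta> = (THE f. deRham f = \<eta> \<and> Reg0 l0 f = 0)"

section \<open>Cochain complexes and special deformation retracts\<close>

(* A graded real vector space is the direct sum, carried by a whole type, of its homogeneous
   parts G k; a complex is then a total space with a differential of degree one. *)
definition graded_space :: "(int \<Rightarrow> 'a::real_vector set) \<Rightarrow> bool" where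
  "graded_space G \<longleftrightarrow> (\<forall>k. subspace (G k)) \<and>
     (\<forall>x. \<exists>!c. (\<forall>k. c k \<in> G k) \<and> finite {k. c k \<noteq> 0} \<and> x = (\<Sum>k | c k \<noteq> 0. c k))"

definition graded_linear ::
  "int \<Rightarrow> (int \<Rightarrow> 'a::real_vector set) \<Rightarrow> (int \<Rightarrow> 'b::real_vector set) \<Rightarrow> ('a \<Rightarrow> 'b) \<Rightarrow> bool" where
  "graded_linear r G G' f \<longleftrightarrow> linear f \<and> (\<forall>k. f ` G k \<subseteq> G' (k + r))"

definition cochain_complex :: "(int \<Rightarrow> 'a::real_vector set) \<Rightarrow> ('a \<Rightarrow> 'a) \<Rightarrow> bool" where
  "cochain_complex G d \<longleftrightarrow> graded_space G \<and> graded_linear 1 G G d \<and> (\<forall>x. d (d x) = 0)"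

definition cochain_map ::
  "(int \<Rightarrow> 'a::real_vector set) \<Rightarrow> ('a \<Rightarrow> 'a) \<Rightarrow> (int \<Rightarrow> 'b::real_vector set) \<Rightarrow> ('b \<Rightarrow> 'b) \<Rightarrow>
    ('a \<Rightarrow> 'b) \<Rightarrow> bool" where
  "cochain_map G d G' d' f \<longleftrightarrow> graded_linear 0 G G' f \<and> (\<forall>x. f (d x) = d' (f x))"

definition special_deformation_retract ::
  "(int \<Rightarrow> 'a::real_vector set) \<Rightarrow> ('a \<Rightarrow> 'a) \<Rightarrow> (int \<Rightarrow> 'b::real_vector set) \<Rightarrow> ('b \<Rightarrow> 'b) \<Rightarrow>
    ('b \<Rightarrow> 'a) \<Rightarrow> ('a \<Rightarrow> 'b) \<Rightarrow> ('a \<Rightarrow> 'a) \<Rightarrow> bool" where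
  "special_deformation_retract G D G' d I P H \<longleftrightarrow>
     cochain_complex G D \<and> cochain_complex G' d \<and>
     cochain_map G' d G D I \<and> cochain_map G D G' d P \<and> graded_linear (-1) G G H \<and>
     (\<forall>y. P (I y) = y) \<and>
     (\<forall>x. D (H x) + H (D x) = x - I (P x)) \<and>
     (\<forall>x. H (H x) = 0) \<and> (\<forall>x. P (H x) = 0) \<and> (\<forall>y. H (I y) = 0)"

section \<open>The relative face-diagram complex and the normal-form complex\<close>

(* (f, \<eta>, a0, a1) stands for f in degree 0 plus (\<eta>; a0, a1) in degree 1. *)
type_synonym rel_cochain = "log_fun \<times> log_form \<times> real \<times> real"

definition R_part :: "int \<Rightarrow> rel_cochain set" where
  "R_part k = (if k = 0 then {(f, 0, 0, 0) | f. True}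
     else if k = 1 then {(0, \<eta>, a0, a1) | \<eta> a0 a1. True} else {0})"

definition D_I :: "real \<Rightarrow> real \<Rightarrow> rel_cochain \<Rightarrow> rel_cochain" where
  "D_I l0 l1 = (\<lambda>(f, \<eta>, a0, a1). (0, deRham f, - Reg0 l0 f, Reg1 l1 f))"

(* (x, y0, y1) stands for x e + y0 v0 + y1 v1. *)
type_synonym nf_cochain = "real \<times> real \<times> real"

definition C_nf_part :: "int \<Rightarrow> nf_cochain set" where
  "C_nf_part k = (if k = 0 then {(x, 0, 0) | x. True}
     else if k = 1 then {(0, y0, y1) | y0 y1. True} else {0})"

definition d_nf :: "nf_cochain \<Rightarrow> nf_cochain" where
  "d_nf = (\<lambda>(x, y0, y1). (0, - x, x))"

definition I_I :: "nf_cochain \<Rightarrow> rel_cochain" where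
  "I_I = (\<lambda>(x, y0, y1). (x *\<^sub>R 1, 0, y0, y1))"

definition P_I :: "real \<Rightarrow> real \<Rightarrow> rel_cochain \<Rightarrow> nf_cochain" where
  "P_I l0 l1 = (\<lambda>(f, \<eta>, a0, a1). (Reg0 l0 f, a0, a1 - Tr l0 l1 \<eta>))"

definition H_I :: "real \<Rightarrow> rel_cochain \<Rightarrow> rel_cochain" where
  "H_I l0 = (\<lambda>(f, \<eta>, a0, a1). (P0 l0 \<eta>, 0, 0, 0))"

end

theory Submission
  imports Defs
begin

text \<open>The algebra reduces to three facts: the value of a logarithmic expansion at a scale is
  well defined, every logarithmic form has a primitive that is unique up to a constant, and
  \<open>Tr\<close> satisfies Stokes' formula. The primitives stay in the logarithmic class because a smooth
  function up to the boundary is its boundary value plus \<open>t\<close> times a smooth function: this trades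
  \<open>(ln t)\<^sup>k dt/t\<close> for \<open>(ln t)\<^sup>k\<^sup>+\<^sup>1 / (k+1)\<close> and, after integrating the smooth coefficient
  by parts, lowers the power of \<open>ln t\<close> in \<open>h(t) (ln t)\<^sup>k dt\<close>.\<close>

section \<open>Smooth functions\<close>

lemma smooth_onE:
  assumes "smooth_on S f"
  obtains D where "D 0 = f"
    "\<And>k t. t \<in> S \<Longrightarrow> (D k has_real_derivative D (Suc k) t) (at t within S)"
  using assms unfolding smooth_on_def by blast

lemma smooth_on_continuous_on:
  assumes "smooth_on S f"
  shows "continuous_on S f"
  using smooth_on_derivative[OF assms] DERIV_continuous_on by metis

text \<open>Prepending \<open>F\<close> to a sequence of successive derivatives of \<open>h\<close>
  gives such a sequence for \<open>F\<close>.\<close>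

lemma smooth_on_primitive:
  assumes "smooth_on S h" "\<And>t. t \<in> S \<Longrightarrow> (F has_real_derivative h t) (at t within S)"
  shows "smooth_on S F"
proof -
  obtain D where D: "D 0 = h"
    "\<And>k t. t \<in> S \<Longrightarrow> (D k has_real_derivative D (Suc k) t) (at t within S)"
    using assms(1) by (rule smooth_onE) blast
  show ?thesis unfolding smooth_on_def
    by (rule exI[of _ "\<lambda>k. case k of 0 \<Rightarrow> F | Suc k \<Rightarrow> D k"])
      (auto split: nat.split simp: assms(2) D)
qed

text \<open>The mean of \<open>h\<close> over the segment from \<open>c\<close> to \<open>t\<close> is smooth up to the boundary by
  differentiation under the integral sign; it serves both as a primitive and as Hadamard's
  quotient.\<close>

lemma smooth_on_mean:
  fixes S :: "real set"
  assumes h: "smooth_on S h" and S: "convex S" "c \<in> S"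
  defines "m \<equiv> \<lambda>t. integral {0..1} (\<lambda>s. h (c + (t - c) * s))"
  shows "smooth_on S m"
    and "t \<in> S \<Longrightarrow> ((\<lambda>t. (t - c) * m t) has_real_derivative h t) (at t within S)"
proof -
  obtain D where D0: "D 0 = h"
    and D: "\<And>k t. t \<in> S \<Longrightarrow> (D k has_real_derivative D (Suc k) t) (at t within S)"
    using h by (rule smooth_onE) blast
  have cont: "continuous_on S (D k)" for k
    using D by (rule DERIV_continuous_on)
  have mem: "c + (t - c) * s \<in> S" if "t \<in> S" "s \<in> {0..1}" for t s
    using convexD_alt[OF S(1) S(2) that(1), of s] that(2) by (simp add: algebra_simps)
  \<comment> \<open>\<open>E k\<close> is the k-th derivative of \<open>m\<close>: each
    differentiation in \<open>t\<close> under the integral sign brings out one factor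
    \<open>s\<close>.\<close>
  define E where "E k t = integral (cbox 0 1) (\<lambda>s. s ^ k * D k (c + (t - c) * s))" for k t
  have cont_s: "continuous_on {0..1} (\<lambda>s. s ^ j * D k (c + (t - c) * s))" if "t \<in> S" for j k t
    using mem[OF that] by (intro continuous_intros continuous_on_compose2[OF cont]) auto
  have E: "(E k has_real_derivative E (Suc k) t) (at t within S)" if t: "t \<in> S" for k t
    unfolding E_def
  proof (rule leibniz_rule_field_derivative[OF _ _ _ t S(1)])
    fix t s :: real assume ts: "t \<in> S" "s \<in> cbox 0 1"
    have "(D k \<circ> (\<lambda>t. c + (t - c) * s) has_real_derivative D (Suc k) (c + (t - c) * s) * s)
        (at t within S)"
    proof (rule DERIV_image_chain)
      show "(D k has_real_derivative D (Suc k) (c + (t - c) * s))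
          (at (c + (t - c) * s) within (\<lambda>t. c + (t - c) * s) ` S)"
        by (rule DERIV_subset[OF D]) (use mem ts in auto)
    qed (auto intro!: derivative_eq_intros)
    from DERIV_cmult[OF this, of "s ^ k"]
    show "((\<lambda>t. s ^ k * D k (c + (t - c) * s)) has_real_derivative
        s ^ Suc k * D (Suc k) (c + (t - c) * s)) (at t within S)"
      by (simp add: o_def mult_ac)
  next
    fix t assume "t \<in> S"
    then show "(\<lambda>s. s ^ k * D k (c + (t - c) * s)) integrable_on cbox 0 1"
      using integrable_continuous_real[OF cont_s[of t k k]] by simp
  next
    show "continuous_on (S \<times> cbox 0 1) (\<lambda>(t, s). s ^ Suc k * D (Suc k) (c + (t - c) * s))"
      unfolding case_prod_beta
      by (intro continuous_intros continuous_on_compose2[OF cont]) (use mem in auto)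
  qed
  have m: "m = E 0" unfolding m_def E_def D0 by simp
  show "smooth_on S m" unfolding smooth_on_def m using E by blast
  assume t: "t \<in> S"
  \<comment> \<open>\<open>?d\<close> is the derivative of \<open>s * h (c + (t - c) * s)\<close> in
    \<open>s\<close>. Its integral over [0, 1] is \<open>h t\<close> by the fundamental theorem and
    \<open>E 0 t + (t - c) * E (Suc 0) t\<close> termwise; the latter is the derivative of
    \<open>(t - c) * m t\<close>. The powers of \<open>s\<close> stay unevaluated so that the terms
    match the definition of \<open>E\<close>.\<close>
  let ?d = "\<lambda>s. s ^ 0 * D 0 (c + (t - c) * s) + (t - c) * (s ^ Suc 0 * D (Suc 0) (c + (t - c) * s))"
  have "(?d has_integral (1 * D 0 (c + (t - c) * 1) - 0 * D 0 (c + (t - c) * 0))) {0..1}"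
  proof (rule fundamental_theorem_of_calculus)
    fix s :: real assume s: "s \<in> {0..1}"
    have "(D 0 \<circ> (\<lambda>s. c + (t - c) * s) has_real_derivative D (Suc 0) (c + (t - c) * s) * (t - c))
        (at s within {0..1})"
    proof (rule DERIV_image_chain)
      show "(D 0 has_real_derivative D (Suc 0) (c + (t - c) * s))
          (at (c + (t - c) * s) within (\<lambda>s. c + (t - c) * s) ` {0..1})"
        by (rule DERIV_subset[OF D]) (use mem t s in auto)
    qed (auto intro!: derivative_eq_intros)
    from DERIV_mult[OF DERIV_ident this[unfolded o_def]]
    have "((\<lambda>s. s * D 0 (c + (t - c) * s)) has_real_derivative ?d s) (at s within {0..1})"
      by (simp add: algebra_simps)
    then show "((\<lambda>s. s * D 0 (c + (t - c) * s)) has_vector_derivative ?d s) (at s within {0..1})"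
      by (simp add: has_real_derivative_iff_has_vector_derivative)
  qed simp
  then have "(?d has_integral h t) {0..1}"
    by (simp add: D0)
  moreover have "((\<lambda>s. s ^ k * D k (c + (t - c) * s)) has_integral E k t) {0..1}" for k
    unfolding E_def cbox_interval
    by (rule integrable_integral[OF integrable_continuous_real[OF cont_s[OF t]]])
  then have "(?d has_integral E 0 t + (t - c) * E (Suc 0) t) {0..1}"
    by (intro has_integral_add has_integral_mult_right)
  ultimately have "E 0 t + (t - c) * E (Suc 0) t = h t"
    by (rule has_integral_unique[rotated])
  moreover have "((\<lambda>t. (t - c) * E 0 t) has_real_derivative E 0 t + (t - c) * E (Suc 0) t)
      (at t within S)"
    using DERIV_mult[OF DERIV_diff[OF DERIV_ident DERIV_const] E[OF t, of 0], of c]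
    by (simp add: add.commute mult.commute)
  ultimately show "((\<lambda>t. (t - c) * m t) has_real_derivative h t) (at t within S)"
    by (simp add: m)
qed

lemma eq_up_to_const_if_same_derivative:
  fixes S :: "real set"
  assumes "convex S" "\<And>t. t \<in> S \<Longrightarrow> (F has_real_derivative h t) (at t within S)"
    "\<And>t. t \<in> S \<Longrightarrow> (G has_real_derivative h t) (at t within S)"
  obtains c where "\<And>t. t \<in> S \<Longrightarrow> F t = G t + c"
proof -
  have "\<exists>c. \<forall>t\<in>S. F t - G t = c"
    by (rule has_field_derivative_zero_constant[OF assms(1)])
      (use DERIV_diff[OF assms(2,3)] in simp)
  then obtain c where "\<forall>t\<in>S. F t - G t = c" ..
  then show ?thesis by (intro that[of c]) force
qed

text \<open>The quotient is the mean of \<open>h'\<close> over the segment from 0 to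
  \<open>t\<close>: multiplied by \<open>t\<close> it is a primitive of \<open>h'\<close>, so it
  differs from \<open>h\<close> by a constant, which is \<open>h 0\<close>.\<close>

lemma smooth_on_Hadamard:
  assumes "smooth_on {0..<e} h" "e > 0"
  obtains q where "smooth_on {0..<e} q" "\<And>t. t \<in> {0..<e} \<Longrightarrow> h t = h 0 + t * q t"
proof -
  obtain h' where h': "smooth_on {0..<e} h'"
    "\<And>t. t \<in> {0..<e} \<Longrightarrow> (h has_real_derivative h' t) (at t within {0..<e})"
    using assms(1) by (rule smooth_on_derivative) blast
  note q = smooth_on_mean[OF h'(1), of 0, simplified, OF assms(2)]
  let ?q = "\<lambda>t. integral {0..1} (\<lambda>s. h' (t * s))"
  obtain c where c: "\<And>t. t \<in> {0..<e} \<Longrightarrow> h t = t * ?q t + c"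
    by (rule eq_up_to_const_if_same_derivative[of "{0..<e}" h h' "\<lambda>t. t * ?q t"])
      (use h'(2) q(2) in auto)
  have "h 0 = c" using c[of 0] assms(2) by simp
  with c q(1) show ?thesis by (intro that[of ?q]) simp_all
qed

section \<open>Regularized values\<close>

lemma log_expansion_cong:
  assumes "log_expansion n c f" "e > 0" "\<And>t. t \<in> {0<..<e} \<Longrightarrow> g t = f t"
  shows "log_expansion n c g"
proof -
  from assms(1) obtain e' where "e' > 0" "\<forall>j\<le>n. smooth_on {0..<e'} (c j)"
    "\<forall>t\<in>{0<..<e'}. f t = (\<Sum>j\<le>n. c j t * ln t ^ j)"
    unfolding log_expansion_def by blast
  with assms(2,3) show ?thesis unfolding log_expansion_def
    by (intro exI[of _ "min e e'"]) (auto elim!: smooth_on_subset)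
qed

lemma log_poly_germ_cong:
  assumes "log_poly f" "e > 0" "\<And>t. t \<in> {0<..<e} \<Longrightarrow> g t = f t"
  shows "log_poly g"
  using assms log_expansion_cong unfolding log_poly_def by meson

text \<open>Zero coefficients are added so that two expansions can be combined coefficientwise. The
  polynomials in \<open>x\<close>, whose values at \<open>ln l\<close> are the regularized values,
  do not change.\<close>

lemma log_expansion_same_length:
  assumes "log_expansion n c f" "log_expansion m d g"
  obtains N c' d' where "log_expansion N c' f" "log_expansion N d' g"
    "\<And>x. (\<Sum>j\<le>N. c' j 0 * x ^ j) = (\<Sum>j\<le>n. c j 0 * x ^ j)"
    "\<And>x. (\<Sum>j\<le>N. d' j 0 * x ^ j) = (\<Sum>j\<le>m. d j 0 * x ^ j)"
proof -
  let ?N = "max n m"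
  let ?pad = "\<lambda>n c j. if j \<le> n then c j else (\<lambda>_. 0 :: real)"
  have *: "(\<Sum>j\<le>?N. ?pad k b j 0 * x ^ j) = (\<Sum>j\<le>k. b j 0 * x ^ j)" if "k \<le> ?N"
    for k x and b :: "nat \<Rightarrow> real \<Rightarrow> real"
    by (rule sum.mono_neutral_cong_right) (use that in auto)
  show ?thesis
    by (rule that[OF log_expansion_pad[OF assms(1), of ?N] log_expansion_pad[OF assms(2), of ?N]])
      (simp_all add: *)
qed

lemma log_expansion_lin:
  assumes "log_expansion n c f" "log_expansion n d g"
  shows "log_expansion n (\<lambda>j t. a * c j t + b * d j t) (\<lambda>t. a * f t + b * g t)"
proof -
  obtain e1 where "e1 > 0" "\<forall>j\<le>n. smooth_on {0..<e1} (c j)"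
    "\<forall>t\<in>{0<..<e1}. f t = (\<Sum>j\<le>n. c j t * ln t ^ j)"
    using assms(1) unfolding log_expansion_def by blast
  moreover obtain e2 where "e2 > 0" "\<forall>j\<le>n. smooth_on {0..<e2} (d j)"
    "\<forall>t\<in>{0<..<e2}. g t = (\<Sum>j\<le>n. d j t * ln t ^ j)"
    using assms(2) unfolding log_expansion_def by blast
  ultimately show ?thesis unfolding log_expansion_def
    by (intro exI[of _ "min e1 e2"])
      (auto intro!: smooth_on_add smooth_on_cmult elim!: smooth_on_subset
        simp: sum_distrib_left sum.distrib algebra_simps)
qed

text \<open>With \<open>u = - ln t\<close> this is, up to sign, \<open>u ^ j / exp u\<close> as
  \<open>u\<close> tends to infinity.\<close>

lemma tendsto_times_ln_power: "((\<lambda>t::real. t * ln t ^ j) \<longlongrightarrow> 0) (at_right 0)"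
proof -
  have "filterlim (\<lambda>t::real. - ln t) at_top (at_right 0)"
    using ln_at_0 by (simp add: filterlim_uminus_at_top)
  from tendsto_mult_right_zero[OF filterlim_compose[OF tendsto_power_div_exp_0[of j] this],
      of "(-1) ^ j"]
  have "((\<lambda>t::real. (-1) ^ j * ((- ln t) ^ j / exp (- ln t))) \<longlongrightarrow> 0) (at_right 0)" .
  moreover have "(-1) ^ j * ((- ln t) ^ j / exp (- ln t)) = t * ln t ^ j"
    if "t \<in> {0<..<1}" for t :: real
  proof -
    have "(-1) ^ j * (- ln t) ^ j = ln t ^ j"
      using power_mult_distrib[of "-1" "- ln t" j] by simp
    then show ?thesis using that by (simp add: exp_minus divide_inverse mult_ac)
  qed
  then have "\<forall>\<^sub>F t in at_right (0::real). (-1) ^ j * ((- ln t) ^ j / exp (- ln t)) = t * ln t ^ j"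
    by (rule eventually_at_rightI[OF _ zero_less_one])
  ultimately show ?thesis by (rule Lim_transform_eventually)
qed

text \<open>Replacing each coefficient by its value at 0 costs \<open>O(t)\<close> times a power of \<open>ln t\<close>, hence
  leaves a polynomial in \<open>ln t\<close> that tends to 0 while \<open>ln t\<close> tends to minus infinity.\<close>

lemma log_expansion_of_zero:
  assumes "log_expansion n c (\<lambda>_. 0)"
  shows "(\<Sum>j\<le>n. c j 0 * x ^ j) = 0"
proof -
  obtain e where e: "e > 0" "\<And>j. j \<le> n \<Longrightarrow> smooth_on {0..<e} (c j)"
    "\<And>t. t \<in> {0<..<e} \<Longrightarrow> (\<Sum>j\<le>n. c j t * ln t ^ j) = 0"
    using assms unfolding log_expansion_def by metis
  have lim_j: "((\<lambda>t. (c j t - c j 0) * ln t ^ j) \<longlongrightarrow> 0) (at_right 0)" if j: "j \<le> n" for j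
  proof -
    obtain q where q: "smooth_on {0..<e} q" "\<And>t. t \<in> {0..<e} \<Longrightarrow> c j t = c j 0 + t * q t"
      using e(2)[OF j] e(1) by (rule smooth_on_Hadamard) blast
    have "(q \<longlongrightarrow> q 0) (at 0 within {0..<e})"
      using smooth_on_continuous_on[OF q(1)] e(1) unfolding continuous_on by simp
    moreover have "at 0 within {0..<e} = at_right 0"
      using e(1) by (intro at_within_nhd[of _ "{-1<..<e}"]) auto
    ultimately have "((\<lambda>t. q t * (t * ln t ^ j)) \<longlongrightarrow> 0) (at_right 0)"
      using tendsto_mult[OF _ tendsto_times_ln_power[of j], of q "q 0"] by simp
    moreover have "\<forall>\<^sub>F t in at_right 0. q t * (t * ln t ^ j) = (c j t - c j 0) * ln t ^ j"
    proof (rule eventually_at_rightI[OF _ e(1)])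
      fix t assume "t \<in> {0<..<e}"
      then have "c j t - c j 0 = t * q t" using q(2)[of t] by simp
      then show "q t * (t * ln t ^ j) = (c j t - c j 0) * ln t ^ j" by (simp add: mult_ac)
    qed
    ultimately show ?thesis by (rule Lim_transform_eventually)
  qed
  have "((\<lambda>t. \<Sum>j\<le>n. (c j t - c j 0) * ln t ^ j) \<longlongrightarrow> 0) (at_right 0)"
    using tendsto_sum[of "{..n}", OF lim_j] by simp
  moreover have "\<forall>\<^sub>F t in at_right 0. (\<Sum>j\<le>n. (c j t - c j 0) * ln t ^ j) =
      - (\<Sum>j\<le>n. c j 0 * ln t ^ j)"
    by (rule eventually_at_rightI[OF _ e(1)])
      (use e(3) in \<open>simp add: left_diff_distrib sum_subtractf\<close>)
  ultimately have "((\<lambda>t. - (\<Sum>j\<le>n. c j 0 * ln t ^ j)) \<longlongrightarrow> 0) (at_right 0)"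
    by (rule Lim_transform_eventually)
  then have lim: "((\<lambda>t. \<Sum>j\<le>n. c j 0 * ln t ^ j) \<longlongrightarrow> 0) (at_right 0)"
    by (intro tendsto_minus_cancel[of _ 0]) simp
  \<comment> \<open>A nonzero higher coefficient would keep the polynomial in \<open>ln t\<close> at
    least 1 in absolute value near 0, since \<open>ln t\<close> tends to minus infinity; this
    contradicts \<open>lim\<close>.\<close>
  have higher: "c k 0 = 0" if "k \<noteq> 0" "k \<le> n" for k
  proof (rule ccontr)
    assume "c k 0 \<noteq> 0"
    then have "\<forall>\<^sub>F z in at_infinity. norm (\<Sum>j\<le>n. c j 0 * z ^ j) \<ge> 1"
      using that by (intro polyfun_extremal) auto
    then have "\<forall>\<^sub>F t in at_right 0. norm (\<Sum>j\<le>n. c j 0 * ln t ^ j) \<ge> 1"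
      using filterlim_mono[OF ln_at_0 at_bot_le_at_infinity order_refl]
      by (auto simp: filterlim_iff)
    moreover have "\<forall>\<^sub>F t in at_right 0. norm (\<Sum>j\<le>n. c j 0 * ln t ^ j) < 1"
      using tendstoD[OF lim, of 1] by simp
    ultimately have "\<forall>\<^sub>F t in at_right (0::real). False" by eventually_elim simp
    then show False by simp
  qed
  have const: "(\<Sum>j\<le>n. c j 0 * y ^ j) = c 0 0" for y
    using higher by (subst sum.mono_neutral_right[of _ "{0}"]) auto
  with lim have "c 0 0 = 0" by (simp add: tendsto_const_iff)
  with const show ?thesis by simp
qed

text \<open>Two expansions of \<open>f\<close> subtract to an expansion of zero, so their boundary
  polynomials agree. Hence the description in \<open>reg\<close> is well defined and any one
  expansion computes it.\<close>

lemma reg_eq: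
  assumes "log_expansion n c f"
  shows "reg l f = (\<Sum>j\<le>n. c j 0 * ln l ^ j)"
  unfolding reg_def
proof (rule the_equality)
  fix r assume "\<exists>m d. log_expansion m d f \<and> r = (\<Sum>j\<le>m. d j 0 * ln l ^ j)"
  then obtain m d where d: "log_expansion m d f" "r = (\<Sum>j\<le>m. d j 0 * ln l ^ j)" by blast
  obtain N c' d' where N: "log_expansion N c' f" "log_expansion N d' f"
    "\<And>x. (\<Sum>j\<le>N. c' j 0 * x ^ j) = (\<Sum>j\<le>n. c j 0 * x ^ j)"
    "\<And>x. (\<Sum>j\<le>N. d' j 0 * x ^ j) = (\<Sum>j\<le>m. d j 0 * x ^ j)"
    using assms d(1) by (rule log_expansion_same_length) blast
  have "log_expansion N (\<lambda>j t. 1 * c' j t + (-1) * d' j t) (\<lambda>t. 0)"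
    using log_expansion_lin[OF N(1,2), of 1 "-1"] by simp
  from log_expansion_of_zero[OF this, of "ln l"] N(3,4) d(2)
  show "r = (\<Sum>j\<le>n. c j 0 * ln l ^ j)"
    by (simp add: left_diff_distrib sum_subtractf)
qed (use assms in blast)

lemma reg_lin:
  assumes "log_poly f" "log_poly g"
  shows "reg l (\<lambda>t. a * f t + b * g t) = a * reg l f + b * reg l g"
proof -
  obtain n c m d where "log_expansion n c f" "log_expansion m d g"
    using assms unfolding log_poly_def by blast
  then obtain N c d where N: "log_expansion N c f" "log_expansion N d g"
    by (metis log_expansion_same_length)
  show ?thesis
    unfolding reg_eq[OF N(1)] reg_eq[OF N(2)] reg_eq[OF log_expansion_lin[OF N]]
    by (simp add: sum_distrib_left sum.distrib algebra_simps)
qed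

text \<open>Regularization sees only the germ at 0. This absorbs the extension by zero outside (0,1)
  and identities that hold only near an endpoint.\<close>

lemma reg_cong:
  assumes "log_poly f" "e > 0" "\<And>t. t \<in> {0<..<e} \<Longrightarrow> g t = f t"
  shows "reg l g = reg l f"
proof -
  obtain n c where c: "log_expansion n c f" using assms(1) unfolding log_poly_def by blast
  show ?thesis
    using reg_eq[OF c, of l] reg_eq[OF log_expansion_cong[OF c assms(2,3)], of l] by simp
qed

lemma reg_const: "reg l (\<lambda>_. a) = a"
proof -
  have "log_expansion 0 (\<lambda>_ _. a) (\<lambda>_. a)"
    unfolding log_expansion_def by (auto intro: exI[of _ 1])
  from reg_eq[OF this] show ?thesis by simp
qed

section \<open>Primitives of logarithmic forms\<close>

text \<open>Integration by parts with the primitive \<open>t * ?m t\<close> of \<open>h\<close>: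
  differentiating the logarithm produces \<open>1 / t\<close>, which cancels the factor
  \<open>t\<close> and leaves the monomial \<open>?m t * ln t ^ k\<close>. The induction generalizes
  \<open>h\<close> because the mean takes its place.\<close>

lemma log_monom_primitive:
  assumes "e > 0" "smooth_on {0..<e} h"
  shows "\<exists>F. log_poly F \<and> (\<forall>t\<in>{0<..<e}. (F has_real_derivative h t * ln t ^ k) (at t))"
  using assms(2)
proof (induction k arbitrary: h)
  case (0 h)
  note m = smooth_on_mean[OF 0, of 0, simplified, OF assms(1)]
  let ?F = "\<lambda>t. t * integral {0..1} (\<lambda>s. h (t * s))"
  have F: "(?F has_real_derivative h t) (at t)" if "t \<in> {0<..<e}" for t
    using m(2)[of t] that at_within_interior[of t "{0..<e}"] by auto
  have "smooth_on {0..<e} ?F" using m(2) by (intro smooth_on_primitive[OF 0]) auto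
  then have "log_poly ?F" using log_poly_monom[OF assms(1), of ?F 0] by simp
  with F show ?case by (intro exI[of _ ?F]) simp
next
  case (Suc k h)
  note m = smooth_on_mean[OF Suc.prems, of 0, simplified, OF assms(1)]
  let ?m = "\<lambda>t. integral {0..1} (\<lambda>s. h (t * s))"
  have F: "((\<lambda>t. t * ?m t) has_real_derivative h t) (at t)" if "t \<in> {0<..<e}" for t
    using m(2)[of t] that at_within_interior[of t "{0..<e}"] by auto
  have "smooth_on {0..<e} (\<lambda>t. t * ?m t)"
    using m(2) by (intro smooth_on_primitive[OF Suc.prems]) auto
  note lp = log_poly_monom[OF assms(1) this, of "Suc k"]
  obtain G where G: "log_poly G"
    "\<And>t. t \<in> {0<..<e} \<Longrightarrow> (G has_real_derivative ?m t * ln t ^ k) (at t)"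
    using Suc.IH[OF m(1)] by blast
  have "((\<lambda>t. (t * ?m t) * ln t ^ Suc k + (- real (Suc k)) * G t) has_real_derivative
      h t * ln t ^ Suc k) (at t)" if t: "t \<in> {0<..<e}" for t
  proof -
    have "((\<lambda>t. ln t ^ Suc k) has_real_derivative real (Suc k) * ln t ^ k / t) (at t)"
      using t by (auto intro!: derivative_eq_intros simp del: power_Suc)
    from DERIV_add[OF DERIV_mult[OF F[OF t] this] DERIV_cmult[OF G(2)[OF t], of "- real (Suc k)"]]
    show ?thesis using t by (simp add: field_simps)
  qed
  with log_poly_add[OF lp log_poly_cmult[OF G(1), of "- real (Suc k)"]] show ?case by blast
qed

text \<open>Hadamard's quotient splits off the only singular term,
  \<open>h 0 * ln t ^ k / t\<close>, which integrates to a higher power of \<open>ln t\<close>; the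
  remainder \<open>q t * ln t ^ k\<close> is the previous case.\<close>

lemma log_monom_dlog_primitive:
  assumes "e > 0" "smooth_on {0..<e} h"
  shows "\<exists>F. log_poly F \<and> (\<forall>t\<in>{0<..<e}. (F has_real_derivative h t * ln t ^ k / t) (at t))"
proof -
  obtain q where q: "smooth_on {0..<e} q" "\<And>t. t \<in> {0..<e} \<Longrightarrow> h t = h 0 + t * q t"
    using assms(2,1) by (rule smooth_on_Hadamard) blast
  obtain G where G: "log_poly G"
    "\<And>t. t \<in> {0<..<e} \<Longrightarrow> (G has_real_derivative q t * ln t ^ k) (at t)"
    using log_monom_primitive[OF assms(1) q(1)] by blast
  let ?a = "h 0 / real (Suc k)"
  have "((\<lambda>t. ?a * ln t ^ Suc k + G t) has_real_derivative h t * ln t ^ k / t) (at t)"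
    if t: "t \<in> {0<..<e}" for t
  proof -
    have "((\<lambda>t. ln t ^ Suc k) has_real_derivative real (Suc k) * ln t ^ k / t) (at t)"
      using t by (auto intro!: derivative_eq_intros simp del: power_Suc)
    from DERIV_add[OF DERIV_cmult[OF this, of ?a] G(2)[OF t]]
    have "((\<lambda>t. ?a * ln t ^ Suc k + G t) has_real_derivative
        h 0 * ln t ^ k / t + q t * ln t ^ k) (at t)" by simp
    moreover have "h 0 * ln t ^ k / t + q t * ln t ^ k = h t * ln t ^ k / t"
      using t q(2)[of t] by (simp add: field_simps)
    ultimately show ?thesis by simp
  qed
  moreover have "log_poly (\<lambda>t. ?a * ln t ^ Suc k + G t)"
    by (intro log_poly_add log_poly_monom[OF assms(1)] G) simp
  ultimately show ?thesis by blast
qed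

lemma log_form_coeff_primitive:
  assumes "log_form_coeff g"
  obtains F e where "e > 0" "log_poly F"
    "\<And>t. t \<in> {0<..<e} \<Longrightarrow> (F has_real_derivative g t) (at t)"
proof -
  obtain a b n c m d where ac: "log_expansion n c a" and bd: "log_expansion m d b"
    and ev: "\<forall>\<^sub>F t in at_right 0. g t = a t + b t / t"
    using assms unfolding log_form_coeff_def log_poly_def by blast
  obtain e0 where e0: "e0 > 0" "\<And>t. t \<in> {0<..<e0} \<Longrightarrow> g t = a t + b t / t"
    using ev unfolding eventually_at_right_field by auto
  obtain e1 where e1: "e1 > 0" "\<And>j. j \<le> n \<Longrightarrow> smooth_on {0..<e1} (c j)"
    "\<And>t. t \<in> {0<..<e1} \<Longrightarrow> a t = (\<Sum>j\<le>n. c j t * ln t ^ j)"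
    using ac unfolding log_expansion_def by blast
  obtain e2 where e2: "e2 > 0" "\<And>j. j \<le> m \<Longrightarrow> smooth_on {0..<e2} (d j)"
    "\<And>t. t \<in> {0<..<e2} \<Longrightarrow> b t = (\<Sum>j\<le>m. d j t * ln t ^ j)"
    using bd unfolding log_expansion_def by blast
  have "\<forall>j\<in>{..n}. \<exists>F. log_poly F \<and>
      (\<forall>t\<in>{0<..<e1}. (F has_real_derivative c j t * ln t ^ j) (at t))"
    using log_monom_primitive[OF e1(1) e1(2)] by blast
  then obtain A where A: "\<And>j. j \<le> n \<Longrightarrow> log_poly (A j)"
    "\<And>j t. j \<le> n \<Longrightarrow> t \<in> {0<..<e1} \<Longrightarrow> (A j has_real_derivative c j t * ln t ^ j) (at t)"
    unfolding bchoice_iff by blast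
  have "\<forall>j\<in>{..m}. \<exists>F. log_poly F \<and>
      (\<forall>t\<in>{0<..<e2}. (F has_real_derivative d j t * ln t ^ j / t) (at t))"
    using log_monom_dlog_primitive[OF e2(1) e2(2)] by blast
  then obtain B where B: "\<And>j. j \<le> m \<Longrightarrow> log_poly (B j)"
    "\<And>j t. j \<le> m \<Longrightarrow> t \<in> {0<..<e2} \<Longrightarrow> (B j has_real_derivative d j t * ln t ^ j / t) (at t)"
    unfolding bchoice_iff by blast
  show ?thesis
  proof (rule that[of "min e0 (min e1 e2)" "\<lambda>t. (\<Sum>j\<le>n. A j t) + (\<Sum>j\<le>m. B j t)"])
    fix t assume t: "t \<in> {0<..<min e0 (min e1 e2)}"
    then have "g t = (\<Sum>j\<le>n. c j t * ln t ^ j) + (\<Sum>j\<le>m. d j t * ln t ^ j / t)"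
      using e0(2) e1(3) e2(3) by (simp add: sum_divide_distrib)
    then show "((\<lambda>t. (\<Sum>j\<le>n. A j t) + (\<Sum>j\<le>m. B j t)) has_real_derivative g t) (at t)"
      using t A(2) B(2) by (auto intro!: DERIV_add DERIV_sum)
  qed (use e0 e1 e2 A B in \<open>auto intro!: log_poly_add log_poly_sum\<close>)
qed

text \<open>Near 0, \<open>G\<close> differs only by a constant from the logarithmic primitive
  already constructed there. This is how a primitive defined on all of (0,1) inherits its boundary
  behaviour.\<close>

lemma log_poly_if_log_form_coeff_deriv:
  assumes "log_form_coeff g" "\<And>t. 0 < t \<Longrightarrow> t < 1 \<Longrightarrow> (G has_real_derivative g t) (at t)"
  shows "log_poly G"
proof -
  obtain F e where F: "e > 0" "log_poly F"
    "\<And>t. t \<in> {0<..<e} \<Longrightarrow> (F has_real_derivative g t) (at t)"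
    using assms(1) by (rule log_form_coeff_primitive) blast
  obtain c where "\<And>t. t \<in> {0<..<min e 1} \<Longrightarrow> G t = F t + c"
    by (rule eq_up_to_const_if_same_derivative[of "{0<..<min e 1}" G g F])
      (use F(3) assms(2) in \<open>auto intro: has_field_derivative_at_within\<close>)
  then show ?thesis
    using F(1)
    by (intro log_poly_germ_cong[OF log_poly_add[OF F(2) log_poly_const[of c]], of "min e 1"]) auto
qed

section \<open>The de Rham differential and the regularized integral\<close>

lemma Rep_log_fun_deRham_deriv:
  assumes "t \<in> {0<..<1}"
  shows "(Rep_log_fun f has_real_derivative Rep_log_form (deRham f) t) (at t)"
proof -
  have "smooth_on {0<..<1} (Rep_log_fun f)" using Rep_log_fun[of f] by simp
  then obtain f' where
    "\<And>t. t \<in> {0<..<1} \<Longrightarrow> (Rep_log_fun f has_real_derivative f' t) (at t within {0<..<1})"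
    using smooth_on_derivative by metis
  from this[OF assms] have "(Rep_log_fun f has_real_derivative f' t) (at t)"
    using at_within_open[OF assms] by simp
  then show ?thesis using assms DERIV_imp_deriv by (force simp: deRham.rep_eq)
qed

lemma deRham_eqI:
  assumes "\<And>t. t \<in> {0<..<1} \<Longrightarrow>
    (Rep_log_fun f has_real_derivative Rep_log_form \<eta> t) (at t)"
  shows "deRham f = \<eta>"
proof -
  have "Rep_log_form (deRham f) t = Rep_log_form \<eta> t" for t
    using Rep_log_form[of \<eta>] DERIV_imp_deriv[OF assms] by (auto simp: deRham.rep_eq)
  then show ?thesis by (simp add: Rep_log_form_inject[symmetric] fun_eq_iff)
qed

lemma linear_deRham: "linear deRham"
proof (rule linearI)
  fix f g :: log_fun
  show "deRham (f + g) = deRham f + deRham g"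
    by (rule deRham_eqI) (unfold plus_log_fun.rep_eq plus_log_form.rep_eq,
      rule DERIV_add; rule Rep_log_fun_deRham_deriv)
next
  fix a and f :: log_fun
  show "deRham (a *\<^sub>R f) = a *\<^sub>R deRham f"
    by (rule deRham_eqI) (unfold scaleR_log_fun.rep_eq scaleR_log_form.rep_eq,
      rule DERIV_cmult, rule Rep_log_fun_deRham_deriv)
qed

text \<open>The primitive is taken from the interior base point 1/2, as \<open>t - 1/2\<close> times
  a mean value, so that it is defined on all of (0,1) at once; its behaviour at each endpoint is
  then read off from its derivative.\<close>

lemma deRham_surj: "surj deRham"
  unfolding surj_def
proof
  fix \<eta>
  define g where "g = Rep_log_form \<eta>"
  have g: "smooth_on {0<..<1} g" "log_form_coeff g" "log_form_coeff (\<lambda>s. g (1 - s))"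
    using Rep_log_form[of \<eta>] by (auto simp: g_def)
  define m where "m t = integral {0..1} (\<lambda>s. g (1/2 + (t - 1/2) * s))" for t
  define f where "f t = (if t \<in> {0<..<1} then (t - 1/2) * m t else 0)" for t
  have f': "(f has_real_derivative g t) (at t)" if t: "t \<in> {0<..<1}" for t
  proof -
    have "((\<lambda>t. (t - 1/2) * m t) has_real_derivative g t) (at t within {0<..<1})"
      unfolding m_def by (rule smooth_on_mean(2)[OF g(1)]) (use t in auto)
    then have "((\<lambda>t. (t - 1/2) * m t) has_real_derivative g t) (at t)"
      using at_within_open[OF t] by simp
    then show ?thesis
      by (rule has_field_derivative_transform_within_open[of _ _ _ "{0<..<1}"])
        (use t in \<open>auto simp: f_def\<close>)
  qed
  have "smooth_on {0<..<1} f"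
    by (rule smooth_on_primitive[OF g(1)]) (rule has_field_derivative_at_within[OF f'])
  moreover have "log_poly f"
    by (rule log_poly_if_log_form_coeff_deriv[OF g(2)]) (use f' in simp)
  moreover have "log_poly (\<lambda>s. f (1 - s))"
  proof (rule log_poly_if_log_form_coeff_deriv)
    \<comment> \<open>The factor -1 is the derivative of the boundary coordinate change
      \<open>1 - s\<close>.\<close>
    show "log_form_coeff (\<lambda>s. (-1) * g (1 - s))" by (rule log_form_coeff_cmult[OF g(3)])
    fix s :: real assume s: "0 < s" "s < 1"
    have "((\<lambda>s. f (1 - s)) has_real_derivative g (1 - s) * (-1)) (at s)"
      by (rule DERIV_chain2[OF f']) (use s in \<open>auto intro!: derivative_eq_intros\<close>)
    then show "((\<lambda>s. f (1 - s)) has_real_derivative (-1) * g (1 - s)) (at s)" by simp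
  qed
  ultimately have "Rep_log_fun (Abs_log_fun f) = f"
    by (intro Abs_log_fun_inverse) (simp add: f_def)
  then have "deRham (Abs_log_fun f) = \<eta>"
    by (intro deRham_eqI) (simp add: f' flip: g_def)
  then show "\<exists>f. \<eta> = deRham f" by blast
qed

text \<open>The unit \<open>1\<close> is the indicator of (0,1), so constants on the interval are
  exactly its multiples, including the extension by zero.\<close>

lemma deRham_eq_0_iff: "deRham f = 0 \<longleftrightarrow> (\<exists>c. f = c *\<^sub>R 1)"
proof
  assume 0: "deRham f = 0"
  obtain c where c: "\<And>t. t \<in> {0<..<1} \<Longrightarrow> Rep_log_fun f t = 0 + c"
    by (rule eq_up_to_const_if_same_derivative[of "{0<..<1}" "Rep_log_fun f" "\<lambda>_. 0" "\<lambda>_. 0"])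
      (use Rep_log_fun_deRham_deriv[of _ f] in
        \<open>auto simp: 0 zero_log_form.rep_eq intro: has_field_derivative_at_within\<close>)
  have "Rep_log_fun f t = Rep_log_fun (c *\<^sub>R 1) t" for t
    using c[of t] Rep_log_fun[of f] by (auto simp: scaleR_log_fun.rep_eq one_log_fun.rep_eq)
  then have "f = c *\<^sub>R 1" by (simp add: Rep_log_fun_inject[symmetric] fun_eq_iff)
  then show "\<exists>c. f = c *\<^sub>R 1" ..
next
  assume "\<exists>c. f = c *\<^sub>R 1"
  then obtain c where f: "f = c *\<^sub>R 1" ..
  show "deRham f = 0"
  proof (rule deRham_eqI)
    fix t :: real assume t: "t \<in> {0<..<1}"
    have "((\<lambda>_. c) has_real_derivative 0) (at t)" by simp
    then show "(Rep_log_fun f has_real_derivative Rep_log_form 0 t) (at t)"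
      unfolding zero_log_form.rep_eq
      by (rule has_field_derivative_transform_within_open[of _ _ _ "{0<..<1}"])
        (use t in \<open>auto simp: f scaleR_log_fun.rep_eq one_log_fun.rep_eq\<close>)
  qed
qed

section \<open>Linearity and normalization of the regularized values\<close>

lemma Rep_log_fun_log_poly:
  "log_poly (Rep_log_fun f)" "log_poly (\<lambda>s. Rep_log_fun f (1 - s))"
  using Rep_log_fun[of f] by auto

lemma linear_Reg0: "linear (Reg0 l)"
proof (rule linearI)
  fix f g :: log_fun
  show "Reg0 l (f + g) = Reg0 l f + Reg0 l g"
    using reg_lin[OF Rep_log_fun_log_poly(1) Rep_log_fun_log_poly(1), of l 1 f 1 g]
    by (simp add: Reg0_def plus_log_fun.rep_eq)
next
  fix a and f :: log_fun
  show "Reg0 l (a *\<^sub>R f) = a *\<^sub>R Reg0 l f"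
    using reg_lin[OF Rep_log_fun_log_poly(1) Rep_log_fun_log_poly(1), of l a f 0 f]
    by (simp add: Reg0_def scaleR_log_fun.rep_eq)
qed

lemma linear_Reg1: "linear (Reg1 l)"
proof (rule linearI)
  fix f g :: log_fun
  show "Reg1 l (f + g) = Reg1 l f + Reg1 l g"
    using reg_lin[OF Rep_log_fun_log_poly(2) Rep_log_fun_log_poly(2), of l 1 f 1 g]
    by (simp add: Reg1_def plus_log_fun.rep_eq)
next
  fix a and f :: log_fun
  show "Reg1 l (a *\<^sub>R f) = a *\<^sub>R Reg1 l f"
    using reg_lin[OF Rep_log_fun_log_poly(2) Rep_log_fun_log_poly(2), of l a f 0 f]
    by (simp add: Reg1_def scaleR_log_fun.rep_eq)
qed

lemma Reg0_one: "Reg0 l 1 = 1"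
  unfolding Reg0_def
  by (subst reg_cong[OF log_poly_const[of 1], of 1]) (auto simp: one_log_fun.rep_eq reg_const)

lemma Reg1_one: "Reg1 l 1 = 1"
  unfolding Reg1_def
  by (subst reg_cong[OF log_poly_const[of 1], of 1]) (auto simp: one_log_fun.rep_eq reg_const)

section \<open>Stokes' formula and the normalized primitive\<close>

lemma integral_deRham:
  assumes "0 < a" "a \<le> b" "b < 1"
  shows "integral {a..b} (Rep_log_form (deRham f)) = Rep_log_fun f b - Rep_log_fun f a"
proof (rule integral_unique, rule fundamental_theorem_of_calculus)
  fix x assume "x \<in> {a..b}"
  then have "x \<in> {0<..<1}" using assms by auto
  from Rep_log_fun_deRham_deriv[OF this, of f]
  show "(Rep_log_fun f has_vector_derivative Rep_log_form (deRham f) x) (at x within {a..b})"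
    by (simp add: has_real_derivative_iff_has_vector_derivative has_vector_derivative_at_within)
qed (use assms in simp)

text \<open>On each half the integral is a difference of values of \<open>f\<close>; regularization
  turns the moving endpoint into a regularized value, and the two values at the cut 1/2 cancel. The
  explicit factors 1 and -1 fit \<open>reg_lin\<close>.\<close>

lemma Tr_deRham: "Tr l0 l1 (deRham f) = Reg1 l1 f - Reg0 l0 f"
proof -
  let ?F = "Rep_log_fun f"
  let ?m = "\<lambda>_::real. ?F (1/2)"
  have "reg l0 (\<lambda>a. integral {a..1/2} (Rep_log_form (deRham f)))
      = reg l0 (\<lambda>a. 1 * ?m a + (-1) * ?F a)"
    by (rule reg_cong[of _ "1/2"],
        intro log_poly_add log_poly_cmult log_poly_const Rep_log_fun_log_poly)
      (auto simp: integral_deRham)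
  moreover have "\<dots> = ?F (1/2) - Reg0 l0 f"
    by (subst reg_lin) (auto simp: Reg0_def reg_const Rep_log_fun_log_poly)
  moreover have "reg l1 (\<lambda>s. integral {1/2..1 - s} (Rep_log_form (deRham f)))
      = reg l1 (\<lambda>s. 1 * ?F (1 - s) + (-1) * ?m s)"
    by (rule reg_cong[of _ "1/2"],
        intro log_poly_add log_poly_cmult log_poly_const Rep_log_fun_log_poly)
      (auto simp: integral_deRham)
  moreover have "\<dots> = Reg1 l1 f - ?F (1/2)"
    by (subst reg_lin) (auto simp: Reg1_def reg_const Rep_log_fun_log_poly)
  ultimately show ?thesis unfolding Tr_def by linarith
qed

text \<open>Two candidates differ by a multiple of \<open>1\<close>, and \<open>Reg0_one\<close>
  shows that the normalization at 0 forces this multiple to vanish.\<close>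

lemma P0_eqI:
  assumes "deRham f = \<eta>" "Reg0 l f = 0"
  shows "P0 l \<eta> = f"
  unfolding P0_def
proof (rule the_equality)
  fix g assume g: "deRham g = \<eta> \<and> Reg0 l g = 0"
  then have "deRham (g - f) = 0" using assms by (simp add: linear_diff[OF linear_deRham])
  then obtain c where c: "g - f = c *\<^sub>R 1" by (auto simp: deRham_eq_0_iff)
  have "Reg0 l (g - f) = 0" using g assms by (simp add: linear_diff[OF linear_Reg0])
  then have "c = 0" by (simp add: c linear_scale[OF linear_Reg0] Reg0_one)
  with c show "g = f" by simp
qed (use assms in simp)

lemma P0_deRham: "P0 l (deRham f) = f - Reg0 l f *\<^sub>R 1"
proof (rule P0_eqI)
  have "deRham (Reg0 l f *\<^sub>R 1) = 0" by (auto simp: deRham_eq_0_iff)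
  then show "deRham (f - Reg0 l f *\<^sub>R 1) = deRham f" by (simp add: linear_diff[OF linear_deRham])
  show "Reg0 l (f - Reg0 l f *\<^sub>R 1) = 0"
    by (simp add: linear_diff[OF linear_Reg0] linear_scale[OF linear_Reg0] Reg0_one)
qed

text \<open>By surjectivity \<open>\<eta>\<close> is some \<open>deRham f\<close>, where
  \<open>P0\<close> is known explicitly: subtract the regularized value at 0.\<close>

lemma shows deRham_P0: "deRham (P0 l \<eta>) = \<eta>" and Reg0_P0: "Reg0 l (P0 l \<eta>) = 0"
proof -
  obtain f where f: "\<eta> = deRham f" using deRham_surj by (rule surjE)
  have "deRham (Reg0 l f *\<^sub>R 1) = 0" by (auto simp: deRham_eq_0_iff)
  then show "deRham (P0 l \<eta>) = \<eta>" by (simp add: f P0_deRham linear_diff[OF linear_deRham])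
  show "Reg0 l (P0 l \<eta>) = 0"
    by (simp add: f P0_deRham linear_diff[OF linear_Reg0] linear_scale[OF linear_Reg0] Reg0_one)
qed

lemma linear_P0: "linear (P0 l)"
  by (rule linearI; rule P0_eqI)
    (simp_all add: linear_add[OF linear_deRham] linear_add[OF linear_Reg0] deRham_P0 Reg0_P0
      linear_scale[OF linear_deRham] linear_scale[OF linear_Reg0])

text \<open>Besides linking the trace to the homotopy, this yields linearity of \<open>Tr\<close>
  from that of \<open>Reg1\<close> and \<open>P0\<close>, without returning to integrals.\<close>

lemma Tr_eq_Reg1_P0: "Tr l0 l1 \<eta> = Reg1 l1 (P0 l0 \<eta>)"
  using Tr_deRham[of l0 l1 "P0 l0 \<eta>"] by (simp add: deRham_P0 Reg0_P0)

section \<open>Two-term complexes\<close>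

text \<open>A family with components in these parts is supported in degrees 0 and 1, so unique
  decomposition reduces to \<open>A\<close> and \<open>B\<close> being complementary.\<close>

lemma graded_space_two_term:
  assumes A: "subspace A" and B: "subspace B" and disj: "A \<inter> B = {0}"
    and span: "\<And>x. \<exists>a\<in>A. \<exists>b\<in>B. x = a + b"
  shows "graded_space (\<lambda>k. if k = 0 then A else if k = 1 then B else {0})"
    (is "graded_space ?G")
  unfolding graded_space_def
proof (intro conjI allI)
  show "subspace (?G k)" for k using A B by (simp add: subspace_single_0)
next
  fix x
  obtain a b where ab: "a \<in> A" "b \<in> B" "x = a + b" using span by blast
  have two: "finite {k. c k \<noteq> 0} \<and> (\<Sum>k | c k \<noteq> 0. c k) = c 0 + c 1"
    if c: "\<And>k. c k \<in> ?G k" for c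
  proof -
    have sub: "{k. c k \<noteq> 0} \<subseteq> {0, 1}"
    proof
      fix k assume "k \<in> {k. c k \<noteq> 0}"
      then show "k \<in> {0, 1}" using c[of k] by (auto split: if_splits)
    qed
    have "(\<Sum>k | c k \<noteq> 0. c k) = (\<Sum>k\<in>{0, 1}. c k)"
      by (rule sum.mono_neutral_left) (use sub in auto)
    then show ?thesis using finite_subset[OF sub] by simp
  qed
  let ?P = "\<lambda>c. (\<forall>k. c k \<in> ?G k) \<and> finite {k. c k \<noteq> 0} \<and> x = (\<Sum>k | c k \<noteq> 0. c k)"
  let ?c = "\<lambda>k::int. if k = 0 then a else if k = 1 then b else 0"
  show "\<exists>!c. ?P c"
  proof (rule ex1I)
    have "\<And>k. ?c k \<in> ?G k" using ab by simp
    from two[of ?c, OF this] this ab(3) show "?P ?c" by simp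
  next
    fix c assume c: "?P c"
    then have mem: "\<And>k. c k \<in> ?G k" by blast
    have x: "a + b = c 0 + c 1" using two[OF mem] c ab(3) by simp
    have c01: "c 0 \<in> A" "c 1 \<in> B" using mem[of 0] mem[of 1] by simp_all
    have "a - c 0 = c 1 - b" using x by (simp add: algebra_simps)
    then have "a - c 0 \<in> A \<inter> B"
      using subspace_diff[OF A ab(1) c01(1)] subspace_diff[OF B c01(2) ab(2)] by auto
    then have "a = c 0" using disj by simp
    moreover from this have "b = c 1" using x by simp
    ultimately have "c k = ?c k" for k using mem[of k] by (auto split: if_splits)
    then show "c = ?c" by blast
  qed
qed

section \<open>The two concrete complexes and the retract\<close>

lemma graded_space_R_part: "graded_space R_part"
  unfolding R_part_def
proof (rule graded_space_two_term)
  fix x :: rel_cochain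
  obtain f \<eta> a0 a1 where "x = (f, \<eta>, a0, a1)" by (cases x)
  then have "x = (f, 0, 0, 0) + (0, \<eta>, a0, a1)" by simp
  then show "\<exists>a\<in>{(f, 0, 0, 0) | f. True}. \<exists>b\<in>{(0, \<eta>, a0, a1) | \<eta> a0 a1. True}. x = a + b"
    by blast
qed (auto simp: subspace_def zero_prod_def)

lemma graded_space_C_nf_part: "graded_space C_nf_part"
  unfolding C_nf_part_def
proof (rule graded_space_two_term)
  fix x :: nf_cochain
  obtain e y0 y1 where "x = (e, y0, y1)" by (cases x)
  then have "x = (e, 0, 0) + (0, y0, y1)" by simp
  then show "\<exists>a\<in>{(x, 0, 0) | x. True}. \<exists>b\<in>{(0, y0, y1) | y0 y1. True}. x = a + b"
    by blast
qed (auto simp: subspace_def zero_prod_def)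

theorem proposition13p8:
  fixes l0 l1 :: real
  assumes "l0 > 0" and "l1 > 0"
  shows "special_deformation_retract R_part (D_I l0 l1) C_nf_part d_nf I_I (P_I l0 l1) (H_I l0)
    \<and> (\<forall>a0 a1. H_I l0 (0, 0, a0, a1) = 0)
    \<and> (\<forall>x. Reg0 l0 (fst (H_I l0 x)) = 0)"
proof -
  have linear: "linear (D_I l0 l1)" "linear d_nf" "linear I_I" "linear (P_I l0 l1)" "linear (H_I l0)"
    by (rule linearI; auto simp: D_I_def d_nf_def I_I_def P_I_def H_I_def Tr_eq_Reg1_P0
        scaleR_add_left linear_add[OF linear_deRham] linear_scale[OF linear_deRham]
        linear_add[OF linear_Reg0] linear_scale[OF linear_Reg0] linear_add[OF linear_Reg1]
        linear_scale[OF linear_Reg1] linear_add[OF linear_P0] linear_scale[OF linear_P0]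
        algebra_simps)+
  note zero = linear_0[OF linear_deRham] linear_0[OF linear_Reg0] linear_0[OF linear_Reg1]
    linear_0[OF linear_P0]
  have deRham_const: "deRham (c *\<^sub>R 1) = 0" for c by (auto simp: deRham_eq_0_iff)
  note defs = D_I_def d_nf_def I_I_def P_I_def H_I_def
  have graded: "graded_linear 1 R_part R_part (D_I l0 l1)"
    "graded_linear 1 C_nf_part C_nf_part d_nf" "graded_linear 0 C_nf_part R_part I_I"
    "graded_linear 0 R_part C_nf_part (P_I l0 l1)" "graded_linear (-1) R_part R_part (H_I l0)"
    unfolding graded_linear_def using linear
    by (auto simp: R_part_def C_nf_part_def defs zero Tr_eq_Reg1_P0 zero_prod_def)
  \<comment> \<open>In degree 0 both sides of the homotopy identity are
    \<open>f - Reg0 l0 f *\<^sub>R 1\<close>, by \<open>P0_deRham\<close>. In degree 1 both are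
    \<open>\<eta>\<close> with endpoint entries 0 and \<open>Tr l0 l1 \<eta>\<close>, by
    \<open>Reg0_P0\<close> and \<open>Tr_eq_Reg1_P0\<close>. Compatibility of \<open>P_I\<close>
    with the differentials is Stokes' formula in the same guise.\<close>
  have "D_I l0 l1 (D_I l0 l1 x) = 0" "H_I l0 (H_I l0 x) = 0" "P_I l0 l1 (H_I l0 x) = 0"
    "P_I l0 l1 (D_I l0 l1 x) = d_nf (P_I l0 l1 x)"
    "D_I l0 l1 (H_I l0 x) + H_I l0 (D_I l0 l1 x) = x - I_I (P_I l0 l1 x)"
    "Reg0 l0 (fst (H_I l0 x)) = 0" for x
    by (cases x; simp add: defs zero zero_prod_def P0_deRham deRham_P0 Reg0_P0
        Tr_eq_Reg1_P0 linear_diff[OF linear_Reg1] linear_scale[OF linear_Reg1] Reg1_one)+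
  \<comment> \<open>That \<open>I_I\<close> is a cochain map amounts to constants being closed with
    both regularized values equal to the constant.\<close>
  moreover have "d_nf (d_nf y) = 0" "P_I l0 l1 (I_I y) = y" "H_I l0 (I_I y) = 0"
    "I_I (d_nf y) = D_I l0 l1 (I_I y)" for y
    by (cases y; simp add: defs zero zero_prod_def Tr_eq_Reg1_P0 deRham_const
        linear_scale[OF linear_Reg0] linear_scale[OF linear_Reg1] Reg0_one Reg1_one)+
  moreover have "H_I l0 (0, 0, a0, a1) = 0" for a0 a1
    by (simp add: H_I_def zero zero_prod_def)
  ultimately show ?thesis
    unfolding special_deformation_retract_def cochain_complex_def cochain_map_def
    using graded graded_space_R_part graded_space_C_nf_part by simp
qed

end
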